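(* Any finite unital 3-field $F$ of characteristic 1 which is generated by a single element $x$ is isomorphic to $F_0(n)$, where $n$ is the smallest natural number with $(1-x)^{n}=0$ in $\mathcal{U}(F)$. Moreover, if $P=1+\sum_{i=1}^{n-1}\eta_i(x-1)^i\in F_0(n)$ with $P\neq 1$, $k=\min\{i:\eta_i\neq 0\}$, and $n_P$ is the smallest natural number with $(P-1)^{n_P}=0$ (so that the unital 3-subfield of $F_0(n)$ generated by $P$ is isomorphic to $F_0(n_P)$), then $n_P=\lceil n/k\rceil$.
   Context: All rings and 3-fields are commutative. A unital 3-field is a set $F$ with a ternary addition $(a,b,c)\mapsto a+b+c$ and a binary multiplication such that: the ternary addition is associative and invariant under permutation of the summands, and each $a\in F$ has a querelement $\overline a\in F$ with $a+\overline a+b=b$ for all $b\in F$; $F$ is an abelian group under multiplication with unit $1$; and $a(b+c+d)=ab+ac+ad$. Isomorphisms are bijections preserving both operations. $F$ has characteristic 1 if $1+1+1=1$ in $F$. $F$ is generated by $x$ if $F$ is the only unital 3-subfield of $F$ containing $x$. Each unital 3-field is the unit group of a local binary ring $\mathcal{U}(F)=\mathcal{Q}(F)\cup F$ (disjoint union) with residue field $\mathbb{F}_2$ and maximal ideal $\mathcal{Q}(F)=\{q_{a,b}:f\mapsto f+a+b \mid a,b\in F\}$, where $f+g=q_{f,g}$, $q_{a,b}+f=a+b+f$, $q_{a,b}+q_{c,d}=q_{a+b+c,\,d}$, $fq_{a,b}=q_{fa,fb}$, $q_{a,b}q_{c,d}=q_{ac+ad+bc,\,bd}$; the ternary sum of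 $F$ is the binary sum of $\mathcal{U}(F)$ applied twice. For $n\geq 1$, $F_0(n)=\{1+\sum_{i=1}^{n-1}\varepsilon_i(x-1)^i : \varepsilon_i\in\mathbb{F}_2\}\subset\mathbb{F}_2[x]/((x-1)^n)$, with multiplication and ternary addition inherited from this ring; thus $\mathcal{U}(F_0(n))=\mathbb{F}_2[x]/((x-1)^n)$. *)

theory Defs
  imports
    "HOL-Algebra.QuotRing"
    "HOL-Algebra.Algebraic_Closure_Type"
    "HOL-Library.Z2"
begin

section \<open>Unital 3-fields\<close>

record 'a three_field = "'a monoid" +
  tadd :: "'a \<Rightarrow> 'a \<Rightarrow> 'a \<Rightarrow> 'a"

locale unital_3field = comm_group F for F :: "('a, 'm) three_field_scheme" (structure) +
  assumes tadd_closed: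
    "\<lbrakk>a \<in> carrier F; b \<in> carrier F; c \<in> carrier F\<rbrakk> \<Longrightarrow> tadd F a b c \<in> carrier F"
  and tadd_assoc_left:
    "\<lbrakk>a \<in> carrier F; b \<in> carrier F; c \<in> carrier F; d \<in> carrier F; e \<in> carrier F\<rbrakk>
      \<Longrightarrow> tadd F (tadd F a b c) d e = tadd F a (tadd F b c d) e"
  and tadd_assoc_right:
    "\<lbrakk>a \<in> carrier F; b \<in> carrier F; c \<in> carrier F; d \<in> carrier F; e \<in> carrier F\<rbrakk>
      \<Longrightarrow> tadd F a (tadd F b c d) e = tadd F a b (tadd F c d e)"
  \<comment> \<open>these two transpositions generate all permutations of the summands\<close>
  and tadd_swap_left:
    "\<lbrakk>a \<in> carrier F; b \<in> carrier F; c \<in> carrier F\<rbrakk> \<Longrightarrow> tadd F a b c = tadd F b a c"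
  and tadd_swap_right:
    "\<lbrakk>a \<in> carrier F; b \<in> carrier F; c \<in> carrier F\<rbrakk> \<Longrightarrow> tadd F a b c = tadd F a c b"
  and querelement:
    "a \<in> carrier F \<Longrightarrow> \<exists>a'\<in>carrier F. \<forall>b\<in>carrier F. tadd F a a' b = b"
  and distrib:
    "\<lbrakk>a \<in> carrier F; b \<in> carrier F; c \<in> carrier F; d \<in> carrier F\<rbrakk>
      \<Longrightarrow> a \<otimes> tadd F b c d = tadd F (a \<otimes> b) (a \<otimes> c) (a \<otimes> d)"

definition char_one :: "('a, 'm) three_field_scheme \<Rightarrow> bool" where
  "char_one F \<longleftrightarrow> tadd F \<one>\<^bsub>F\<^esub> \<one>\<^bsub>F\<^esub> \<one>\<^bsub>F\<^esub> = \<one>\<^bsub>F\<^esub>"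

definition iso_3field ::
    "('a, 'm) three_field_scheme \<Rightarrow> ('b, 'n) three_field_scheme \<Rightarrow> ('a \<Rightarrow> 'b) set" where
  "iso_3field F G = {h \<in> iso F G. \<forall>a\<in>carrier F. \<forall>b\<in>carrier F. \<forall>c\<in>carrier F.
     h (tadd F a b c) = tadd G (h a) (h b) (h c)}"

definition isomorphic_3field ::
    "('a, 'm) three_field_scheme \<Rightarrow> ('b, 'n) three_field_scheme \<Rightarrow> bool" where
  "isomorphic_3field F G \<longleftrightarrow> iso_3field F G \<noteq> {}"

definition unital_3subfield :: "'a set \<Rightarrow> ('a, 'm) three_field_scheme \<Rightarrow> bool" where
  "unital_3subfield H F \<longleftrightarrow> H \<subseteq> carrier F \<and> unital_3field (F\<lparr>carrier := H\<rparr>)"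

definition generated_by :: "('a, 'm) three_field_scheme \<Rightarrow> 'a \<Rightarrow> bool" where
  "generated_by F x \<longleftrightarrow> x \<in> carrier F \<and>
     (\<forall>H. unital_3subfield H F \<and> x \<in> H \<longrightarrow> H = carrier F)"

definition gen_3subfield :: "('a, 'm) three_field_scheme \<Rightarrow> 'a \<Rightarrow> 'a set" where
  "gen_3subfield F x = \<Inter>{H. unital_3subfield H F \<and> x \<in> H}"


section \<open>The binary ring \<open>U(F) = Q(F) \<union> F\<close>\<close>

text \<open>
  The pair maps are extensional outside \<open>carrier F\<close>, so that equality in \<open>Q(F)\<close> is equality
  of maps on \<open>F\<close>. In \<open>U(F)\<close>, \<open>Inl\<close> marks the elements of \<open>Q(F)\<close> and \<open>Inr\<close> those of \<open>F\<close>.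
  Operations given on representatives are defined by definite description: the result is the
  unique map obtained from any choice of representatives.
\<close>

definition qmap :: "('a, 'm) three_field_scheme \<Rightarrow> 'a \<Rightarrow> 'a \<Rightarrow> 'a \<Rightarrow> 'a" where
  "qmap F a b = (\<lambda>f\<in>carrier F. tadd F f a b)"

definition Q_set :: "('a, 'm) three_field_scheme \<Rightarrow> ('a \<Rightarrow> 'a) set" where
  "Q_set F = {qmap F a b | a b. a \<in> carrier F \<and> b \<in> carrier F}"

fun U_add :: "('a, 'm) three_field_scheme
    \<Rightarrow> ('a \<Rightarrow> 'a) + 'a \<Rightarrow> ('a \<Rightarrow> 'a) + 'a \<Rightarrow> ('a \<Rightarrow> 'a) + 'a" where
  "U_add F (Inr f) (Inr g) = Inl (qmap F f g)"
| "U_add F (Inl q) (Inr f) = Inr (q f)"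
| "U_add F (Inr f) (Inl q) = Inr (q f)"
| "U_add F (Inl p) (Inl q) = Inl (THE r. \<exists>a\<in>carrier F. \<exists>b\<in>carrier F. \<exists>c\<in>carrier F. \<exists>d\<in>carrier F.
     p = qmap F a b \<and> q = qmap F c d \<and> r = qmap F (tadd F a b c) d)"

fun U_mult :: "('a, 'm) three_field_scheme
    \<Rightarrow> ('a \<Rightarrow> 'a) + 'a \<Rightarrow> ('a \<Rightarrow> 'a) + 'a \<Rightarrow> ('a \<Rightarrow> 'a) + 'a" where
  "U_mult F (Inr f) (Inr g) = Inr (f \<otimes>\<^bsub>F\<^esub> g)"
| "U_mult F (Inr f) (Inl q) = Inl (THE r. \<exists>a\<in>carrier F. \<exists>b\<in>carrier F.
     q = qmap F a b \<and> r = qmap F (f \<otimes>\<^bsub>F\<^esub> a) (f \<otimes>\<^bsub>F\<^esub> b))"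
| "U_mult F (Inl q) (Inr f) = Inl (THE r. \<exists>a\<in>carrier F. \<exists>b\<in>carrier F.
     q = qmap F a b \<and> r = qmap F (f \<otimes>\<^bsub>F\<^esub> a) (f \<otimes>\<^bsub>F\<^esub> b))"
| "U_mult F (Inl p) (Inl q) = Inl (THE r. \<exists>a\<in>carrier F. \<exists>b\<in>carrier F. \<exists>c\<in>carrier F. \<exists>d\<in>carrier F.
     p = qmap F a b \<and> q = qmap F c d \<and>
     r = qmap F (tadd F (a \<otimes>\<^bsub>F\<^esub> c) (a \<otimes>\<^bsub>F\<^esub> d) (b \<otimes>\<^bsub>F\<^esub> c)) (b \<otimes>\<^bsub>F\<^esub> d))"

text \<open>The zero is the identity map of \<open>F\<close>, i.e. \<open>qmap F a a'\<close> for a querelement \<open>a'\<close> of \<open>a\<close>.\<close>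

definition U_ring :: "('a, 'm) three_field_scheme \<Rightarrow> (('a \<Rightarrow> 'a) + 'a) ring" where
  "U_ring F = \<lparr>carrier = Inl ` Q_set F \<union> Inr ` carrier F,
     monoid.mult = U_mult F, one = Inr \<one>\<^bsub>F\<^esub>, zero = Inl (\<lambda>f\<in>carrier F. f), add = U_add F\<rparr>"


section \<open>The 3-fields \<open>F\<^sub>0(n)\<close>\<close>

definition F2x :: "bit poly ring" where
  "F2x = ring_of_type_algebra"

definition F2x_ideal :: "nat \<Rightarrow> bit poly set" where
  "F2x_ideal n = PIdl\<^bsub>F2x\<^esub> ([:-1, 1:] ^ n)"

definition F2x_quot :: "nat \<Rightarrow> (bit poly set) ring" where
  "F2x_quot n = F2x Quot F2x_ideal n"

text \<open>The residue class of \<open>1 + \<epsilon>\<^sub>1 (x - 1) + \<dots> + \<epsilon>\<^sub>n\<^sub>-\<^sub>1 (x - 1)\<^sup>n\<^sup>-\<^sup>1\<close>;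
  only the values of \<open>\<epsilon>\<close> on \<open>{1..<n}\<close> matter.\<close>

definition F0_elem :: "nat \<Rightarrow> (nat \<Rightarrow> bit) \<Rightarrow> bit poly set" where
  "F0_elem n \<epsilon> = F2x_ideal n +>\<^bsub>F2x\<^esub> (1 + (\<Sum>i = 1..<n. smult (\<epsilon> i) ([:-1, 1:] ^ i)))"

definition F0 :: "nat \<Rightarrow> (bit poly set) three_field" where
  "F0 n = \<lparr>carrier = range (F0_elem n), monoid.mult = monoid.mult (F2x_quot n), one = \<one>\<^bsub>F2x_quot n\<^esub>,
     tadd = (\<lambda>a b c. a \<oplus>\<^bsub>F2x_quot n\<^esub> b \<oplus>\<^bsub>F2x_quot n\<^esub> c)\<rparr>"


section \<open>Nilpotency index\<close>

definition is_nilpotency_index :: "('a, 'm) ring_scheme \<Rightarrow> 'a \<Rightarrow> nat \<Rightarrow> bool" where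
  "is_nilpotency_index R a n \<longleftrightarrow>
     a [^]\<^bsub>R\<^esub> n = \<zero>\<^bsub>R\<^esub> \<and> (\<forall>m<n. a [^]\<^bsub>R\<^esub> m \<noteq> \<zero>\<^bsub>R\<^esub>)"

end

theory Submission
  imports Defs
begin

text \<open>
  In characteristic 1 the ring \<open>U(F)\<close> has characteristic 2, so sending the variable to \<open>x\<close> extends
  to a ring homomorphism from the polynomials over the field with two elements to \<open>U(F)\<close>. It
  maps \<open>x - 1\<close> to a nilpotent element. A polynomial has the form \<open>(x - 1)\<^sup>m r\<close> with \<open>r(1) = 1\<close>,
  hence \<open>r \<equiv> 1\<close> modulo \<open>x - 1\<close>, so it lies in the kernel iff \<open>m\<close> is at least the nilpotency
  index \<open>n\<close>: the kernel is generated by \<open>(x - 1)\<^sup>n\<close>. The values of the polynomials with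
  \<open>p(1) = 1\<close> form the smallest 3-subfield containing \<open>x\<close>, and they are therefore a copy of
  \<open>F\<^sub>0(n)\<close>. The same argument in \<open>U(F\<^sub>0(n))\<close> handles the 3-subfield generated by \<open>P\<close>, where
  \<open>P - 1 = (x - 1)\<^sup>k r\<close> with \<open>r(1) = 1\<close>, so that \<open>(P - 1)\<^sup>m = 0\<close> iff \<open>n \<le> k m\<close>.
\<close>

section \<open>The binary ring in characteristic 1\<close>

locale char_one_3field = unital_3field +
  assumes char_one: "char_one F"
begin

text \<open>\<open>(F, \<boxplus>)\<close> is an elementary abelian 2-group with neutral element \<open>1\<close>. Every element of \<open>Q(F)\<close> is
  \<open>c + 1\<close> for a unique \<open>c \<in> F\<close>, and \<open>\<boxplus>\<close> is the addition of \<open>Q(F)\<close> in terms of \<open>c\<close>.\<close>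
definition boxplus :: "'a \<Rightarrow> 'a \<Rightarrow> 'a" (infixl "\<boxplus>" 65) where
  "a \<boxplus> b = tadd F a b \<one>"

text \<open>With \<open>q\<close> a querelement of \<open>\<one>\<close>, \<open>f\<close> equals f
  + q + 1. Adding two further ones and reassociating produces 1 + 1 + 1, which characteristic 1
  collapses to 1.\<close>

lemma tadd_one_one:
  assumes "f \<in> carrier F"
  shows "tadd F f \<one> \<one> = f"
proof -
  obtain q where q: "q \<in> carrier F" "\<And>b. b \<in> carrier F \<Longrightarrow> tadd F \<one> q b = b"
    using querelement[of \<one>] by auto
  have f: "tadd F f q \<one> = f"
    using q assms tadd_swap_left[of f q \<one>] tadd_swap_right[of q f \<one>] tadd_swap_left[of q \<one> f] by simp
  have "tadd F f \<one> \<one> = tadd F (tadd F f q \<one>) \<one> \<one>" by (simp add: f)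
  also have "\<dots> = tadd F f q (tadd F \<one> \<one> \<one>)"
    using assms q(1) by (simp add: tadd_assoc_left tadd_assoc_right)
  also have "\<dots> = f" using char_one f by (simp add: char_one_def)
  finally show ?thesis .
qed

lemma boxplus_closed [simp, intro]: "\<lbrakk>a \<in> carrier F; b \<in> carrier F\<rbrakk> \<Longrightarrow> a \<boxplus> b \<in> carrier F"
  by (simp add: boxplus_def tadd_closed)

lemma boxplus_comm: "\<lbrakk>a \<in> carrier F; b \<in> carrier F\<rbrakk> \<Longrightarrow> a \<boxplus> b = b \<boxplus> a"
  by (simp add: boxplus_def tadd_swap_left)

lemma boxplus_assoc:
  assumes "a \<in> carrier F" "b \<in> carrier F" "c \<in> carrier F"
  shows "(a \<boxplus> b) \<boxplus> c = a \<boxplus> (b \<boxplus> c)"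
  using assms by (simp add: boxplus_def tadd_assoc_left tadd_swap_right[of b c])

lemma boxplus_left_comm:
  "\<lbrakk>a \<in> carrier F; b \<in> carrier F; c \<in> carrier F\<rbrakk> \<Longrightarrow> a \<boxplus> (b \<boxplus> c) = b \<boxplus> (a \<boxplus> c)"
  by (metis boxplus_assoc boxplus_comm)

lemma tadd_eq_boxplus:
  assumes "a \<in> carrier F" "b \<in> carrier F" "c \<in> carrier F"
  shows "tadd F a b c = a \<boxplus> (b \<boxplus> c)"
proof -
  have "a \<boxplus> (b \<boxplus> c) = tadd F (tadd F a b c) \<one> \<one>"
    using assms by (simp add: boxplus_def tadd_assoc_left)
  then show ?thesis using assms by (simp add: tadd_one_one tadd_closed)
qed

lemma boxplus_one [simp]: "a \<in> carrier F \<Longrightarrow> a \<boxplus> \<one> = a"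
  by (simp add: boxplus_def tadd_one_one)

lemma one_boxplus [simp]: "a \<in> carrier F \<Longrightarrow> \<one> \<boxplus> a = a"
  using boxplus_comm by fastforce

text \<open>Factoring out \<open>a\<close> reduces the claim to \<open>tadd_one_one\<close>. So
  every element is its own querelement.\<close>

lemma tadd_same:
  assumes "a \<in> carrier F" "f \<in> carrier F"
  shows "tadd F a a f = f"
proof -
  have "tadd F a a f = a \<otimes> tadd F (inv a \<otimes> f) \<one> \<one>"
    using assms by (simp add: distrib m_assoc[symmetric] tadd_swap_left[of a f] tadd_swap_right[of a a f])
  also have "\<dots> = f" using assms by (simp add: tadd_one_one m_assoc[symmetric])
  finally show ?thesis .
qed

lemma boxplus_self [simp]: "a \<in> carrier F \<Longrightarrow> a \<boxplus> a = \<one>"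
  by (simp add: boxplus_def tadd_same)

lemma boxplus_cancel [simp]: "\<lbrakk>a \<in> carrier F; b \<in> carrier F\<rbrakk> \<Longrightarrow> a \<boxplus> (a \<boxplus> b) = b"
  by (simp flip: boxplus_assoc)

lemmas boxplus_ac = boxplus_assoc boxplus_comm boxplus_left_comm

text \<open>The additional summand \<open>a\<close> comes from the \<open>\<one>\<close> hidden in
  \<open>b \<boxplus> c\<close>.\<close>

lemma boxplus_r_distr:
  assumes "a \<in> carrier F" "b \<in> carrier F" "c \<in> carrier F"
  shows "a \<otimes> (b \<boxplus> c) = a \<otimes> b \<boxplus> (a \<otimes> c \<boxplus> a)"
  using assms distrib[of a b c \<one>] by (simp add: tadd_eq_boxplus)

lemma boxplus_l_distr:
  "\<lbrakk>a \<in> carrier F; b \<in> carrier F; c \<in> carrier F\<rbrakk> \<Longrightarrow> (b \<boxplus> c) \<otimes> a = b \<otimes> a \<boxplus> (c \<otimes> a \<boxplus> a)"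
  by (simp add: m_comm[of _ a] boxplus_r_distr)

section \<open>Maps in Q(F) and the operations of U(F) on representatives\<close>

lemma qmap_eq:
  "\<lbrakk>a \<in> carrier F; b \<in> carrier F\<rbrakk> \<Longrightarrow> qmap F a b = qmap F (a \<boxplus> b) \<one>"
  by (auto simp: qmap_def tadd_eq_boxplus fun_eq_iff)

text \<open>A map in Q(F) is determined by its value at \<open>\<one>\<close>, which is
  \<open>a \<boxplus> b\<close>.\<close>

lemma qmap_inject:
  assumes "a \<in> carrier F" "b \<in> carrier F" "c \<in> carrier F" "d \<in> carrier F"
  shows "qmap F a b = qmap F c d \<longleftrightarrow> a \<boxplus> b = c \<boxplus> d"
proof
  assume "qmap F a b = qmap F c d"
  then have "qmap F a b \<one> = qmap F c d \<one>" by simp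
  then show "a \<boxplus> b = c \<boxplus> d" using assms by (simp add: qmap_def tadd_eq_boxplus)
next
  assume "a \<boxplus> b = c \<boxplus> d"
  then show "qmap F a b = qmap F c d"
    using assms qmap_eq[of a b] qmap_eq[of c d] by simp
qed

lemma Q_setE:
  assumes "q \<in> Q_set F"
  obtains c where "c \<in> carrier F" "q = qmap F c \<one>"
  using assms by (auto simp: Q_set_def) (metis boxplus_closed qmap_eq)

lemma qmap_one_eq_iff:
  "\<lbrakk>a \<in> carrier F; b \<in> carrier F; c \<in> carrier F\<rbrakk> \<Longrightarrow> qmap F c \<one> = qmap F a b \<longleftrightarrow> c = a \<boxplus> b"
  by (simp add: qmap_inject)

text \<open>The representatives \<open>(c, \<one>)\<close> and \<open>(d, \<one>)\<close> give
  existence for the definite description. Uniqueness holds because the result depends only on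
  \<open>a \<boxplus> b\<close> and \<open>c' \<boxplus> d'\<close>, the invariants of the two maps.
  The product formulas below follow the same scheme.\<close>

lemma U_add_Q_Q:
  assumes "c \<in> carrier F" "d \<in> carrier F"
  shows "U_add F (Inl (qmap F c \<one>)) (Inl (qmap F d \<one>)) = Inl (qmap F (c \<boxplus> d) \<one>)"
  unfolding U_add.simps
proof (intro arg_cong[where f = Inl] the_equality)
  show "\<exists>a\<in>carrier F. \<exists>b\<in>carrier F. \<exists>c'\<in>carrier F. \<exists>d'\<in>carrier F. qmap F c \<one> = qmap F a b \<and>
      qmap F d \<one> = qmap F c' d' \<and> qmap F (c \<boxplus> d) \<one> = qmap F (tadd F a b c') d'"
    using assms
    by (intro bexI[of _ c] bexI[of _ d] bexI[of _ \<one>]) (simp_all add: tadd_eq_boxplus)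
next
  fix r
  assume "\<exists>a\<in>carrier F. \<exists>b\<in>carrier F. \<exists>c'\<in>carrier F. \<exists>d'\<in>carrier F. qmap F c \<one> = qmap F a b \<and>
      qmap F d \<one> = qmap F c' d' \<and> r = qmap F (tadd F a b c') d'"
  then show "r = qmap F (c \<boxplus> d) \<one>"
    using assms
    by (clarsimp simp: qmap_one_eq_iff) (simp add: qmap_inject tadd_eq_boxplus boxplus_assoc)
qed

lemma U_mult_F_Q:
  assumes "f \<in> carrier F" "d \<in> carrier F"
  shows "U_mult F (Inr f) (Inl (qmap F d \<one>)) = Inl (qmap F (f \<otimes> d \<boxplus> f) \<one>)"
  unfolding U_mult.simps
proof (intro arg_cong[where f = Inl] the_equality)
  show "\<exists>a\<in>carrier F. \<exists>b\<in>carrier F. qmap F d \<one> = qmap F a b \<and>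
      qmap F (f \<otimes> d \<boxplus> f) \<one> = qmap F (f \<otimes> a) (f \<otimes> b)"
    using assms by (intro bexI[of _ d] bexI[of _ \<one>]) (simp_all add: qmap_inject)
next
  fix r
  assume "\<exists>a\<in>carrier F. \<exists>b\<in>carrier F. qmap F d \<one> = qmap F a b \<and>
      r = qmap F (f \<otimes> a) (f \<otimes> b)"
  then show "r = qmap F (f \<otimes> d \<boxplus> f) \<one>"
    using assms
    by (clarsimp simp: qmap_one_eq_iff) (simp add: qmap_inject boxplus_r_distr boxplus_assoc)
qed

lemma U_mult_Q_F:
  "\<lbrakk>f \<in> carrier F; d \<in> carrier F\<rbrakk>
    \<Longrightarrow> U_mult F (Inl (qmap F d \<one>)) (Inr f) = Inl (qmap F (f \<otimes> d \<boxplus> f) \<one>)"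
  using U_mult_F_Q by simp

text \<open>The formula expresses (c + 1)(d + 1) = (c d + c + d) + 1.\<close>

lemma U_mult_Q_Q:
  assumes "c \<in> carrier F" "d \<in> carrier F"
  shows "U_mult F (Inl (qmap F c \<one>)) (Inl (qmap F d \<one>)) = Inl (qmap F (c \<otimes> d \<boxplus> (c \<boxplus> d)) \<one>)"
  unfolding U_mult.simps
proof (intro arg_cong[where f = Inl] the_equality)
  show "\<exists>a\<in>carrier F. \<exists>b\<in>carrier F. \<exists>c'\<in>carrier F. \<exists>d'\<in>carrier F. qmap F c \<one> = qmap F a b \<and>
      qmap F d \<one> = qmap F c' d' \<and> qmap F (c \<otimes> d \<boxplus> (c \<boxplus> d)) \<one> =
      qmap F (tadd F (a \<otimes> c') (a \<otimes> d') (b \<otimes> c')) (b \<otimes> d')"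
    using assms
    by (intro bexI[of _ c] bexI[of _ d] bexI[of _ \<one>]) (simp_all add: tadd_eq_boxplus)
next
  fix r
  assume "\<exists>a\<in>carrier F. \<exists>b\<in>carrier F. \<exists>c'\<in>carrier F. \<exists>d'\<in>carrier F. qmap F c \<one> = qmap F a b \<and>
      qmap F d \<one> = qmap F c' d' \<and> r =
      qmap F (tadd F (a \<otimes> c') (a \<otimes> d') (b \<otimes> c')) (b \<otimes> d')"
  then show "r = qmap F (c \<otimes> d \<boxplus> (c \<boxplus> d)) \<one>"
    using assms
    by (clarsimp simp: qmap_one_eq_iff)
      (simp add: qmap_inject tadd_eq_boxplus boxplus_r_distr boxplus_l_distr boxplus_ac)
qed

section \<open>U(F) as a commutative ring of characteristic 2\<close>

lemma U_ring_simps: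
  "carrier (U_ring F) = Inl ` Q_set F \<union> Inr ` carrier F" "monoid.mult (U_ring F) = U_mult F"
  "one (U_ring F) = Inr \<one>" "add (U_ring F) = U_add F"
  by (simp_all add: U_ring_def)

lemma zero_U_ring: "zero (U_ring F) = Inl (qmap F \<one> \<one>)"
  by (auto simp: U_ring_def qmap_def fun_eq_iff tadd_one_one)

lemma U_ring_cases:
  assumes "z \<in> carrier (U_ring F)"
  obtains c where "c \<in> carrier F" "z = Inl (qmap F c \<one>)" | c where "c \<in> carrier F" "z = Inr c"
  using assms by (auto simp: U_ring_simps elim: Q_setE)

lemma U_ringI [simp]:
  "\<lbrakk>a \<in> carrier F; b \<in> carrier F\<rbrakk> \<Longrightarrow> Inl (qmap F a b) \<in> carrier (U_ring F)"
  "a \<in> carrier F \<Longrightarrow> Inr a \<in> carrier (U_ring F)"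
  by (auto simp: U_ring_simps Q_set_def)

lemma U_add_F_F:
  "\<lbrakk>f \<in> carrier F; g \<in> carrier F\<rbrakk> \<Longrightarrow> U_add F (Inr f) (Inr g) = Inl (qmap F (f \<boxplus> g) \<one>)"
  by (simp flip: qmap_eq)

lemma U_add_F_Q:
  "\<lbrakk>f \<in> carrier F; c \<in> carrier F\<rbrakk> \<Longrightarrow> U_add F (Inr f) (Inl (qmap F c \<one>)) = Inr (f \<boxplus> c)"
  "\<lbrakk>f \<in> carrier F; c \<in> carrier F\<rbrakk> \<Longrightarrow> U_add F (Inl (qmap F c \<one>)) (Inr f) = Inr (f \<boxplus> c)"
  by (simp_all add: qmap_def tadd_eq_boxplus)

lemma U_mult_F_F: "U_mult F (Inr f) (Inr g) = Inr (f \<otimes> g)"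
  by simp

lemmas U_ops = U_add_Q_Q U_add_F_F U_add_F_Q U_mult_F_Q U_mult_Q_F U_mult_Q_Q U_mult_F_F

text \<open>With every element written as c + 1 or c for some c in F, the table \<open>U_ops\<close>
  turns each axiom into an identity for \<open>\<boxplus>\<close> and \<open>\<otimes>\<close> on F.
  Every element is its own negative.\<close>

lemma U_ring_cring: "cring (U_ring F)"
proof (rule cringI)
  show "abelian_group (U_ring F)"
  proof (rule abelian_groupI)
    fix x assume "x \<in> carrier (U_ring F)"
    then show "\<zero>\<^bsub>U_ring F\<^esub> \<oplus>\<^bsub>U_ring F\<^esub> x = x"
      by (cases rule: U_ring_cases) (simp_all add: U_ring_simps(2-) zero_U_ring U_ops del: U_add.simps U_mult.simps)
  next
    fix x assume x: "x \<in> carrier (U_ring F)"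
    then have "x \<oplus>\<^bsub>U_ring F\<^esub> x = \<zero>\<^bsub>U_ring F\<^esub>"
      by (cases rule: U_ring_cases) (simp_all add: U_ring_simps(2-) zero_U_ring U_ops del: U_add.simps U_mult.simps)
    then show "\<exists>y\<in>carrier (U_ring F). y \<oplus>\<^bsub>U_ring F\<^esub> x = \<zero>\<^bsub>U_ring F\<^esub>" using x by blast
  qed (auto elim!: U_ring_cases simp: U_ring_simps(2-) zero_U_ring U_ops boxplus_ac simp del: U_add.simps U_mult.simps)
  show "comm_monoid (U_ring F)"
    by (rule comm_monoidI)
      (auto elim!: U_ring_cases simp: U_ring_simps(2-) U_ops boxplus_r_distr boxplus_l_distr boxplus_ac m_ac
        simp del: U_add.simps U_mult.simps)
  fix x y z assume "x \<in> carrier (U_ring F)" "y \<in> carrier (U_ring F)" "z \<in> carrier (U_ring F)"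
  then show "(x \<oplus>\<^bsub>U_ring F\<^esub> y) \<otimes>\<^bsub>U_ring F\<^esub> z =
     x \<otimes>\<^bsub>U_ring F\<^esub> z \<oplus>\<^bsub>U_ring F\<^esub> y \<otimes>\<^bsub>U_ring F\<^esub> z"
    by (auto elim!: U_ring_cases simp: U_ring_simps(2-) U_ops boxplus_r_distr boxplus_l_distr boxplus_ac m_ac
        simp del: U_add.simps U_mult.simps)
qed

lemma U_ring_add_self: "z \<in> carrier (U_ring F) \<Longrightarrow> z \<oplus>\<^bsub>U_ring F\<^esub> z = \<zero>\<^bsub>U_ring F\<^esub>"
  by (auto elim!: U_ring_cases simp: U_ring_simps(2-) zero_U_ring U_ops simp del: U_add.simps)

lemma U_ring_tadd:
  "\<lbrakk>a \<in> carrier F; b \<in> carrier F; c \<in> carrier F\<rbrakk>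
    \<Longrightarrow> Inr a \<oplus>\<^bsub>U_ring F\<^esub> Inr b \<oplus>\<^bsub>U_ring F\<^esub> Inr c = Inr (tadd F a b c)"
  by (simp add: U_ring_simps U_ops tadd_eq_boxplus boxplus_ac del: U_add.simps)

end

section \<open>Binary polynomials modulo powers of \<open>x - 1\<close>\<close>

lemma bit_add_self: "a + a = (0 :: bit)"
  by (cases a) simp_all

lemma bit_poly_add_self [simp]: "p + p = (0 :: bit poly)"
  by (intro poly_eqI) (simp only: coeff_add coeff_0 bit_add_self)

definition xm1 :: "bit poly" where
  "xm1 = [:-1, 1:]"

lemma xm1_neq_0 [simp]: "xm1 \<noteq> 0"
  by (simp add: xm1_def)

lemma poly_xm1 [simp]: "poly xm1 1 = 0"
  by (simp add: xm1_def)

lemma xm1_dvd_iff: "xm1 dvd p \<longleftrightarrow> poly p 1 = 0"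
  using poly_eq_0_iff_dvd[of p 1] by (simp add: xm1_def)

text \<open>Splitting off the root 1 with its full multiplicity leaves a factor that is nonzero at
  1, and 1 is the only nonzero bit.\<close>

lemma odd_factorization:
  fixes p :: "bit poly"
  assumes "p \<noteq> 0"
  obtains m r where "p = xm1 ^ m * r" "poly r 1 = 1"
  using order_decomp[OF assms, of 1] by (auto simp: xm1_dvd_iff simp flip: xm1_def simp del: uminus_bit_def)

lemma xm1_power_dvd_iff:
  assumes "poly r 1 = 1"
  shows "xm1 ^ n dvd xm1 ^ m * r \<longleftrightarrow> n \<le> m"
proof
  assume *: "xm1 ^ n dvd xm1 ^ m * r"
  show "n \<le> m"
  proof (rule ccontr)
    assume "\<not> n \<le> m"
    then have "xm1 ^ Suc m dvd xm1 ^ m * r"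
      using * by (meson dvd_trans le_imp_power_dvd not_less_eq_eq)
    then have "xm1 dvd r" by simp
    then show False using assms by (simp add: xm1_dvd_iff)
  qed
qed (simp add: le_imp_power_dvd)

lemma odd_inverse_mod:
  assumes "poly p 1 = 1"
  obtains q where "poly q 1 = 1" "xm1 ^ n dvd p * q + 1"
proof -
  \<comment> \<open>The exponent starts at 1, where q = 1 works because p + 1 vanishes at 1. From
    exponent 0, squaring the error would gain nothing.\<close>
  have "\<exists>q. poly q 1 = 1 \<and> xm1 ^ Suc n dvd p * q + 1"
  proof (induction n)
    case 0
    show ?case by (rule exI[of _ 1]) (use assms in \<open>simp add: xm1_dvd_iff\<close>)
  next
    case (Suc n)
    then obtain q where q: "poly q 1 = 1" "xm1 ^ Suc n dvd p * q + 1" by blast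
    \<comment> \<open>Newton step: replacing \<open>q\<close> by \<open>p q\<^sup>2\<close> squares the error \<open>p q + 1\<close>.\<close>
    then have "xm1 ^ Suc n * xm1 ^ Suc n dvd (p * q + 1) * (p * q + 1)"
      by (intro mult_dvd_mono)
    moreover have "(p * q + 1) * (p * q + 1) = p * (p * q * q) + 1"
    proof -
      have "(p * q + 1) * (p * q + 1) = p * (p * q * q) + (p * q + p * q) + 1"
        by (simp add: algebra_simps del: bit_poly_add_self)
      then show ?thesis by simp
    qed
    moreover have "xm1 ^ Suc (Suc n) dvd xm1 ^ Suc n * xm1 ^ Suc n"
      by (simp add: le_imp_power_dvd flip: power_add power_Suc)
    ultimately show ?case
      using assms q(1) by (intro exI[of _ "p * q * q"]) (auto intro: dvd_trans)
  qed
  moreover have "xm1 ^ n dvd xm1 ^ Suc n" by simp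
  ultimately show ?thesis using that dvd_trans by blast
qed

lemma odd_expansion_mod:
  assumes "poly p 1 = 1"
  shows "\<exists>\<epsilon>. xm1 ^ n dvd p + (1 + (\<Sum>i = 1..<n. smult (\<epsilon> i) (xm1 ^ i)))"
proof (induction n)
  case (Suc n)
  then obtain \<epsilon> where e: "xm1 ^ n dvd p + (1 + (\<Sum>i = 1..<n. smult (\<epsilon> i) (xm1 ^ i)))" by blast
  show ?case
  proof (cases n)
    \<comment> \<open>The digit of exponent 0 is fixed to be 1, so this step chooses no digit and
      rests on p(1) = 1.\<close>
    case 0
    then show ?thesis using assms by (auto simp: xm1_dvd_iff)
  next
    case (Suc l)
    obtain s where s: "p + (1 + (\<Sum>i = 1..<n. smult (\<epsilon> i) (xm1 ^ i))) = xm1 ^ n * s"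
      using e by (elim dvdE)
    \<comment> \<open>The next digit is the value at 1 of the cofactor \<open>s\<close> of the
      current error. Adding it makes the cofactor vanish at 1, which yields one more factor x -
      1.\<close>
    define \<delta> where "\<delta> = \<epsilon>(n := poly s 1)"
    have "(\<Sum>i = 1..<Suc n. smult (\<delta> i) (xm1 ^ i)) =
        (\<Sum>i = 1..<n. smult (\<epsilon> i) (xm1 ^ i)) + smult (poly s 1) (xm1 ^ n)"
      using Suc by (simp add: \<delta>_def)
    then have "p + (1 + (\<Sum>i = 1..<Suc n. smult (\<delta> i) (xm1 ^ i))) = xm1 ^ n * s + smult (poly s 1) (xm1 ^ n)"
      by (simp flip: s add: add.assoc)
    also have "\<dots> = xm1 ^ n * (s + [:poly s 1:])" by (simp add: algebra_simps)
    also have "xm1 ^ Suc n dvd \<dots>"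
      unfolding power_Suc2 by (intro mult_dvd_mono dvd_refl) (simp add: xm1_dvd_iff)
    finally show ?thesis by blast
  qed
qed simp

section \<open>The quotient of F_2[x] by (x - 1)^n and F_0(n) inside it\<close>

lemma F2x_simps [simp]:
  "carrier F2x = UNIV" "monoid.mult F2x = (*)" "one F2x = 1" "zero F2x = 0" "add F2x = (+)"
  by (simp_all add: F2x_def ring_of_type_algebra_def)

lemma F2x_cring: "cring F2x"
  unfolding F2x_def by (rule cring_from_type_algebra)

interpretation F2x: cring F2x
  by (rule F2x_cring)

lemma F2x_minus [simp]: "p \<ominus>\<^bsub>F2x\<^esub> q = p + q"
proof -
  have "\<ominus>\<^bsub>F2x\<^esub> q = q" by (rule F2x.minus_equality) simp_all
  then show ?thesis by (simp add: a_minus_def)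
qed

lemma mem_F2x_ideal: "p \<in> F2x_ideal n \<longleftrightarrow> xm1 ^ n dvd p"
  by (auto simp: F2x_ideal_def cgenideal_def dvd_def mult.commute simp flip: xm1_def simp del: uminus_bit_def)

lemma F2x_ideal: "ideal (F2x_ideal n) F2x"
  by (simp add: F2x_ideal_def F2x.cgenideal_ideal flip: xm1_def del: uminus_bit_def)

definition cls :: "nat \<Rightarrow> bit poly \<Rightarrow> bit poly set" where
  "cls n p = F2x_ideal n +>\<^bsub>F2x\<^esub> p"

lemma cls_eq_iff: "cls n p = cls n q \<longleftrightarrow> xm1 ^ n dvd p + q"
  using F2x.quotient_eq_iff_same_a_r_cos[OF F2x_ideal, of p q n] by (simp add: cls_def mem_F2x_ideal)

lemma cls_hom: "cls n \<in> ring_hom F2x (F2x_quot n)"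
  unfolding cls_def F2x_quot_def by (rule ideal.rcos_ring_hom[OF F2x_ideal])

lemma F2x_quot_simps:
  "carrier (F2x_quot n) = range (cls n)"
  "cls n p \<otimes>\<^bsub>F2x_quot n\<^esub> cls n q = cls n (p * q)"
  "cls n p \<oplus>\<^bsub>F2x_quot n\<^esub> cls n q = cls n (p + q)"
  "\<one>\<^bsub>F2x_quot n\<^esub> = cls n 1"
  using ring_hom_mult[OF cls_hom, of p q n] ring_hom_add[OF cls_hom, of p q n] ring_hom_one[OF cls_hom, of n]
  by (simp_all) (auto simp: F2x_quot_def FactRing_def A_RCOSETS_def' cls_def)

lemma F2x_quot_cring: "cring (F2x_quot n)"
  unfolding F2x_quot_def by (rule ideal.quotient_is_cring[OF F2x_ideal F2x_cring])

lemma F2x_quot_zero: "\<zero>\<^bsub>F2x_quot n\<^esub> = cls n 0"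
  using ring_hom_zero[OF cls_hom, of n] F2x_cring F2x_quot_cring by (simp add: cring_def)

lemma F0_elem_cls: "F0_elem n \<eta> = cls n (1 + (\<Sum>i = 1..<n. smult (\<eta> i) (xm1 ^ i)))"
  by (simp add: F0_elem_def cls_def flip: xm1_def del: uminus_bit_def)

text \<open>By \<open>odd_expansion_mod\<close> every class of a polynomial with p(1) = 1 has a
  normal form with digits \<epsilon>. In this description closure under products and triple sums is
  evident.\<close>

lemma carrier_F0: "carrier (F0 n) = cls n ` {p. poly p 1 = 1}"
proof -
  have "poly (1 + (\<Sum>i = 1..<n. smult (\<epsilon> i) (xm1 ^ i))) 1 = 1" for \<epsilon> :: "nat \<Rightarrow> bit"
    by (simp add: poly_sum)
  moreover have "\<exists>\<epsilon>. cls n p = F0_elem n \<epsilon>" if "poly p 1 = 1" for p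
    using odd_expansion_mod[OF that, of n] by (simp add: F0_elem_cls cls_eq_iff)
  ultimately show ?thesis by (force simp: F0_def F0_elem_cls)
qed

lemma nat_pow_cls: "cls n p [^]\<^bsub>F2x_quot n\<^esub> (m::nat) = cls n (p ^ m)"
  by (induction m) (simp_all add: F2x_quot_simps nat_pow_def mult.commute)

section \<open>Evaluation in rings of characteristic 2\<close>

text \<open>Both U(F) and the quotient of F_2[x] by (x - 1)^n are instances, so the two claims share
  one evaluation argument.\<close>

locale char_two_cring = cring +
  assumes char_two: "\<one> \<oplus> \<one> = \<zero>"
begin

lemma add_self [simp]:
  assumes "a \<in> carrier R"
  shows "a \<oplus> a = \<zero>"
proof -
  have "a \<oplus> a = a \<otimes> (\<one> \<oplus> \<one>)" using assms by (simp add: r_distr del: char_two)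
  then show ?thesis using assms by (simp add: char_two)
qed

lemma minus_self [simp]: "a \<in> carrier R \<Longrightarrow> \<ominus> a = a"
  by (simp add: minus_equality)

lemma a_minus_add: "b \<in> carrier R \<Longrightarrow> a \<ominus> b = a \<oplus> b"
  by (simp add: a_minus_def)

lemma add_self_left [simp]: "\<lbrakk>a \<in> carrier R; b \<in> carrier R\<rbrakk> \<Longrightarrow> a \<oplus> (a \<oplus> b) = b"
  by (simp flip: a_assoc)

text \<open>Horner scheme for p(x). The conditional maps the bits into the ring and is additive
  because \<open>\<one> \<oplus> \<one> = \<zero>\<close>.\<close>

definition ev :: "'a \<Rightarrow> bit poly \<Rightarrow> 'a" where
  "ev x p = fold_coeffs (\<lambda>c s. (if c = 0 then \<zero> else \<one>) \<oplus> x \<otimes> s) p \<zero>"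

context
  fixes x assumes x [simp]: "x \<in> carrier R"
begin

lemma ev_0 [simp]: "ev x 0 = \<zero>"
  by (simp add: ev_def)

lemma ev_pCons [simp]: "ev x (pCons c p) = (if c = 0 then \<zero> else \<one>) \<oplus> x \<otimes> ev x p"
  by (cases "c = 0 \<and> p = 0") (auto simp: ev_def)

lemma ev_closed [simp]: "ev x p \<in> carrier R"
  by (induction p) auto

lemma ev_add: "ev x (p + q) = ev x p \<oplus> ev x q"
proof (induction p q rule: poly_induct2)
  case (pCons a p b q)
  then show ?case
    by (cases a; cases b) (auto simp: r_distr a_ac)
qed simp

lemma ev_mult: "ev x (p * q) = ev x p \<otimes> ev x q"
proof (induction p)
  case (pCons a p)
  then show ?case
    by (cases a) (auto simp: ev_add l_distr m_assoc)
qed simp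

lemma ev_1 [simp]: "ev x 1 = \<one>"
  by (simp add: one_pCons)

lemma ev_power: "ev x (p ^ m) = ev x p [^] m"
  by (induction m) (auto simp: ev_mult m_comm)

lemma ev_xm1: "ev x xm1 = \<one> \<oplus> x"
  by (simp add: xm1_def)

lemma ev_eq_zero_iff:
  assumes "is_nilpotency_index R (\<one> \<oplus> x) n"
  shows "ev x p = \<zero> \<longleftrightarrow> xm1 ^ n dvd p"
proof
  assume "xm1 ^ n dvd p"
  then show "ev x p = \<zero>"
    using assms by (elim dvdE) (simp add: ev_mult ev_power ev_xm1 is_nilpotency_index_def)
next
  assume 0: "ev x p = \<zero>"
  show "xm1 ^ n dvd p"
  proof (cases "p = 0")
    case False
    then obtain m r where r: "p = xm1 ^ m * r" "poly r 1 = 1" by (rule odd_factorization)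
    have "n \<le> m"
    proof (rule ccontr)
      assume "\<not> n \<le> m"
      \<comment> \<open>Here l + m = n - 1. Multiplying p by (x - 1)^l gives (x - 1)^(n - 1) plus a
        multiple of (x - 1)^n, so a zero value of p would force (1 + x)^(n - 1) = 0 in the ring,
        against the minimality of n.\<close>
      then obtain l where l: "n = Suc (l + m)" by (metis less_iff_Suc_add not_le add.commute)
      have "xm1 dvd r + 1" using r(2) by (simp add: xm1_dvd_iff)
      then obtain s where "r + 1 = xm1 * s" by (elim dvdE)
      then have "r = 1 + xm1 * s" by (metis add.assoc add.commute add_0 bit_poly_add_self)
      then have "xm1 ^ l * p = xm1 ^ (l + m) + xm1 ^ n * s"
        by (simp add: r(1) l power_add algebra_simps)
      then have "ev x (xm1 ^ l * p) = ev x (xm1 ^ (l + m)) \<oplus> ev x (xm1 ^ n) \<otimes> ev x s"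
        by (simp add: ev_add ev_mult)
      moreover have "ev x (xm1 ^ l * p) = \<zero>" by (simp add: ev_mult 0)
      moreover have "ev x (xm1 ^ n) = \<zero>"
        using assms by (simp add: ev_power ev_xm1 is_nilpotency_index_def)
      ultimately have "ev x (xm1 ^ (l + m)) = \<zero>" by simp
      then have "(\<one> \<oplus> x) [^] (l + m) = \<zero>" by (simp add: ev_power ev_xm1)
      then show False using assms l by (simp add: is_nilpotency_index_def)
    qed
    then show ?thesis by (simp add: r(1) le_imp_power_dvd)
  qed simp
qed

text \<open>In characteristic 2, two values agree iff their sum is zero. Evaluation thus induces an
  injection on the quotient of F_2[x] by (x - 1)^n.\<close>

lemma ev_eq_iff:
  assumes "is_nilpotency_index R (\<one> \<oplus> x) n"
  shows "ev x p = ev x q \<longleftrightarrow> cls n p = cls n q"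
proof -
  have "ev x p = ev x q \<longleftrightarrow> ev x (p + q) = \<zero>"
    using minus_equality[of "ev x p" "ev x q"] by (auto simp: ev_add)
  then show ?thesis by (simp add: cls_eq_iff ev_eq_zero_iff[OF assms])
qed

section \<open>The 3-field of values of odd polynomials\<close>

definition odd_values :: "'a set" where
  "odd_values = ev x ` {p. poly p 1 = 1}"

text \<open>Since p(1) is the parity of the number of terms of p, odd values are sums of an odd
  number of powers of x. Products and ternary sums build these from 1 and x.\<close>

lemma odd_values_minimal:
  assumes "K \<subseteq> carrier R" "\<one> \<in> K" "x \<in> K"
    and mult: "\<And>a b. \<lbrakk>a \<in> K; b \<in> K\<rbrakk> \<Longrightarrow> a \<otimes> b \<in> K"
    and add: "\<And>a b c. \<lbrakk>a \<in> K; b \<in> K; c \<in> K\<rbrakk> \<Longrightarrow> a \<oplus> b \<oplus> c \<in> K"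
  shows "odd_values \<subseteq> K"
proof -
  \<comment> \<open>The tail of an odd polynomial may be even. The induction therefore also covers
    even polynomials, whose values lie in \<open>K\<close> after adding
    \<open>\<one>\<close>.\<close>
  have "(if poly p 1 = 1 then ev x p else \<one> \<oplus> ev x p) \<in> K" for p
  proof (induction p)
    case (pCons a p)
    \<comment> \<open>For an even tail p, the induction hypothesis times x gives x + x p(x) in
      \<open>K\<close>. The ternary sum with x and 1 then replaces the summand x by 1.\<close>
    have *: "x \<oplus> \<one> \<oplus> (x \<oplus> x \<otimes> ev x p) = \<one> \<oplus> x \<otimes> ev x p"
      by (simp add: a_ac)
    show ?case
      using mult[OF \<open>x \<in> K\<close> pCons(2)] add[OF \<open>x \<in> K\<close> \<open>\<one> \<in> K\<close>, of "x \<oplus> x \<otimes> ev x p"]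
      by (cases a; cases "poly p 1") (auto simp: r_distr * split: if_splits)
  qed (use assms in simp)
  then have "ev x p \<in> K" if "poly p 1 = 1" for p
    using that by (metis (full_types))
  then show ?thesis by (auto simp: odd_values_def)
qed

lemma odd_values_subset: "odd_values \<subseteq> carrier R"
  by (auto simp: odd_values_def)

lemma one_odd_values: "\<one> \<in> odd_values"
  unfolding odd_values_def by (rule image_eqI[of _ _ 1]) simp_all

lemma x_odd_values: "x \<in> odd_values"
  unfolding odd_values_def by (rule image_eqI[of _ _ "[:0, 1:]"]) simp_all

lemma mult_odd_values: "\<lbrakk>a \<in> odd_values; b \<in> odd_values\<rbrakk> \<Longrightarrow> a \<otimes> b \<in> odd_values"
  by (auto simp: odd_values_def simp flip: ev_mult)

lemma add_odd_values:
  "\<lbrakk>a \<in> odd_values; b \<in> odd_values; c \<in> odd_values\<rbrakk> \<Longrightarrow> a \<oplus> b \<oplus> c \<in> odd_values"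
  by (auto simp: odd_values_def simp flip: ev_add)

text \<open>Evaluation kills (x - 1)^n, so an inverse modulo (x - 1)^n evaluates to a true
  inverse.\<close>

lemma inverse_odd_values:
  assumes "is_nilpotency_index R (\<one> \<oplus> x) n" "a \<in> odd_values"
  obtains b where "b \<in> odd_values" "a \<otimes> b = \<one>"
proof -
  obtain p where p: "poly p 1 = 1" "a = ev x p" using assms(2) by (auto simp: odd_values_def)
  obtain q where q: "poly q 1 = 1" "xm1 ^ n dvd p * q + 1" using p(1) by (rule odd_inverse_mod)
  then have "ev x (p * q) = ev x 1"
    unfolding ev_eq_iff[OF assms(1)] cls_eq_iff by simp
  then have "a \<otimes> ev x q = \<one>" by (simp add: p ev_mult)
  then show ?thesis using q(1) that by (auto simp: odd_values_def)
qed

text \<open>The map \<open>e\<close> allows \<open>G\<close> to be either F, sitting in U(F) by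
  \<open>Inr\<close>, or a subset of the ring itself.\<close>

lemma odd_values_isomorphic_F0:
  fixes G :: "('g, 'm) three_field_scheme"
  assumes n: "is_nilpotency_index R (\<one> \<oplus> x) n"
    and e: "bij_betw e (carrier G) odd_values"
    and G: "\<And>a b. \<lbrakk>a \<in> carrier G; b \<in> carrier G\<rbrakk> \<Longrightarrow> e (a \<otimes>\<^bsub>G\<^esub> b) = e a \<otimes> e b"
      "\<And>a b c. \<lbrakk>a \<in> carrier G; b \<in> carrier G; c \<in> carrier G\<rbrakk> \<Longrightarrow> e (tadd G a b c) = e a \<oplus> e b \<oplus> e c"
  shows "isomorphic_3field G (F0 n)"
proof -
  \<comment> \<open>Any polynomial with value \<open>a\<close> serves: by \<open>ev_eq_iff\<close>
    all of them have the same residue class.\<close>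
  define h where "h a = cls n (SOME p. ev x p = a)" for a
  have h: "h (ev x p) = cls n p" for p
    unfolding h_def ev_eq_iff[OF n, symmetric] by (rule someI) simp
  have rep: "\<exists>p. poly p 1 = 1 \<and> e a = ev x p" if "a \<in> carrier G" for a
    using bij_betw_apply[OF e that] by (auto simp: odd_values_def)
  have "inj_on h odd_values"
    by (auto simp: inj_on_def odd_values_def h ev_eq_iff[OF n])
  moreover have "h ` odd_values = carrier (F0 n)"
    by (simp add: odd_values_def carrier_F0 image_image h)
  ultimately have "bij_betw (h \<circ> e) (carrier G) (carrier (F0 n))"
    using e by (intro bij_betw_trans[OF e]) (simp add: bij_betw_def)
  moreover have "h (e (a \<otimes>\<^bsub>G\<^esub> b)) = h (e a) \<otimes>\<^bsub>F0 n\<^esub> h (e b)" if ab: "a \<in> carrier G" "b \<in> carrier G" for a b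
  proof -
    obtain p q where "e a = ev x p" "e b = ev x q" using rep ab by metis
    then show ?thesis using ab by (simp add: G F0_def h F2x_quot_simps flip: ev_mult)
  qed
  moreover have "h (e (tadd G a b c)) = tadd (F0 n) (h (e a)) (h (e b)) (h (e c))"
    if ab: "a \<in> carrier G" "b \<in> carrier G" "c \<in> carrier G" for a b c
  proof -
    obtain p q r where "e a = ev x p" "e b = ev x q" "e c = ev x r" using rep ab by metis
    then show ?thesis using ab by (simp add: G F0_def h F2x_quot_simps flip: ev_add)
  qed
  ultimately have "h \<circ> e \<in> iso_3field G (F0 n)"
    by (auto simp: iso_3field_def iso_def hom_def bij_betw_def)
  then show ?thesis by (auto simp: isomorphic_3field_def)
qed

end

text \<open>In characteristic 2 every element is its own querelement, and the algebraic laws are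
  inherited from the ring. What remains is closure and inverses.\<close>

lemma unital_3field_of_subset:
  fixes G :: "('a, 'm) three_field_scheme"
  assumes K: "carrier G \<subseteq> carrier R"
    and ops: "monoid.mult G = monoid.mult R" "\<one>\<^bsub>G\<^esub> = \<one>" "\<And>a b c. tadd G a b c = a \<oplus> b \<oplus> c"
    and one: "\<one> \<in> carrier G"
    and mult: "\<And>a b. \<lbrakk>a \<in> carrier G; b \<in> carrier G\<rbrakk> \<Longrightarrow> a \<otimes> b \<in> carrier G"
    and add: "\<And>a b c. \<lbrakk>a \<in> carrier G; b \<in> carrier G; c \<in> carrier G\<rbrakk> \<Longrightarrow> a \<oplus> b \<oplus> c \<in> carrier G"
    and inv: "\<And>a. a \<in> carrier G \<Longrightarrow> \<exists>b\<in>carrier G. a \<otimes> b = \<one>"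
  shows "unital_3field G"
proof -
  have [simp]: "a \<in> carrier R" if "a \<in> carrier G" for a using K that by blast
  have add': "a \<oplus> (b \<oplus> c) \<in> carrier G" if "a \<in> carrier G" "b \<in> carrier G" "c \<in> carrier G" for a b c
    using add[OF that] that by (simp add: a_assoc)
  have quer: "\<exists>a'\<in>carrier G. \<forall>b\<in>carrier G. a \<oplus> (a' \<oplus> b) = b" if "a \<in> carrier G" for a
    using that by (intro bexI[of _ a]) simp_all
  have "comm_group G"
  proof (rule comm_groupI)
    fix a assume "a \<in> carrier G"
    then show "\<exists>b\<in>carrier G. b \<otimes>\<^bsub>G\<^esub> a = \<one>\<^bsub>G\<^esub>"
      using inv[of a] by (auto simp: ops m_comm)
  qed (auto simp: ops one mult m_ac)
  then show ?thesis
    by (intro unital_3field.intro unital_3field_axioms.intro)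
      (auto simp: ops add' quer r_distr a_ac)
qed

end

section \<open>Generated 3-fields\<close>

lemma F2x_quot_char_two_cring: "char_two_cring (F2x_quot n)"
  by (simp add: char_two_cring_def char_two_cring_axioms_def F2x_quot_cring F2x_quot_simps F2x_quot_zero)

lemma (in char_one_3field) U_ring_char_two_cring: "char_two_cring (U_ring F)"
  by (simp add: char_two_cring_def char_two_cring_axioms_def U_ring_cring U_ring_add_self
      cring.cring_simprules(6))

lemma is_nilpotency_index_exists:
  fixes m :: nat
  assumes "a [^]\<^bsub>R\<^esub> m = \<zero>\<^bsub>R\<^esub>"
  obtains n where "is_nilpotency_index R a n"
proof
  show "is_nilpotency_index R a (LEAST m :: nat. a [^]\<^bsub>R\<^esub> m = \<zero>\<^bsub>R\<^esub>)"
    unfolding is_nilpotency_index_def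
  proof (intro conjI allI impI)
    show "a [^]\<^bsub>R\<^esub> (LEAST m :: nat. a [^]\<^bsub>R\<^esub> m = \<zero>\<^bsub>R\<^esub>) = \<zero>\<^bsub>R\<^esub>"
      using assms by (rule LeastI)
  qed (rule not_less_Least)
qed

section \<open>Finite 3-fields generated by one element\<close>

context char_one_3field
begin

lemma unital_3subfieldI:
  assumes "H \<subseteq> carrier F" "\<one> \<in> H"
    and mult: "\<And>a b. \<lbrakk>a \<in> H; b \<in> H\<rbrakk> \<Longrightarrow> a \<otimes> b \<in> H"
    and inv: "\<And>a. a \<in> H \<Longrightarrow> inv a \<in> H"
    and add: "\<And>a b c. \<lbrakk>a \<in> H; b \<in> H; c \<in> H\<rbrakk> \<Longrightarrow> tadd F a b c \<in> H"
  shows "unital_3subfield H F"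
proof -
  have [simp]: "a \<in> carrier F" if "a \<in> H" for a using assms(1) that by blast
  have "comm_group (F\<lparr>carrier := H\<rparr>)"
  proof (rule comm_groupI)
    fix a assume "a \<in> carrier (F\<lparr>carrier := H\<rparr>)"
    then show "\<exists>b\<in>carrier (F\<lparr>carrier := H\<rparr>). b \<otimes>\<^bsub>F\<lparr>carrier := H\<rparr>\<^esub> a = \<one>\<^bsub>F\<lparr>carrier := H\<rparr>\<^esub>"
      by (intro bexI[of _ "inv a"]) (simp_all add: inv)
  qed (auto simp: assms m_ac)
  moreover have "\<exists>a'\<in>H. \<forall>b\<in>H. tadd F a a' b = b" if "a \<in> H" for a
    using that by (intro bexI[of _ a]) (simp_all add: tadd_same)
  ultimately show ?thesis
    unfolding unital_3subfield_def
  proof (intro conjI assms unital_3field.intro unital_3field_axioms.intro)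
    let ?H = "F\<lparr>carrier := H\<rparr>"
    fix a b c assume abc: "a \<in> carrier ?H" "b \<in> carrier ?H" "c \<in> carrier ?H"
    then show "tadd ?H a b c = tadd ?H b a c"
      using tadd_swap_left[of a b c] by simp
    show "tadd ?H a b c = tadd ?H a c b"
      using abc tadd_swap_right[of a b c] by simp
  qed (auto simp: add distrib tadd_assoc_left tadd_assoc_right)
qed

lemma finite_U_ring:
  assumes "finite (carrier F)"
  shows "finite (carrier (U_ring F))"
proof -
  have "Q_set F \<subseteq> (\<lambda>c. qmap F c \<one>) ` carrier F" by (auto elim: Q_setE)
  then have "finite (Q_set F)" using assms by (rule finite_subset[OF _ finite_imageI])
  then show ?thesis using assms by (simp add: U_ring_simps)
qed

text \<open>Since \<open>1 + Q(F) \<subseteq> F\<close> consists of units, \<open>y\<^sup>i = y\<^sup>j\<close> with \<open>i < j\<close> forces \<open>y\<^sup>i = 0\<close>.\<close>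
lemma Q_nilpotent:
  assumes fin: "finite (carrier F)" and q: "q \<in> Q_set F"
  shows "\<exists>m::nat. Inl q [^]\<^bsub>U_ring F\<^esub> m = \<zero>\<^bsub>U_ring F\<^esub>"
proof -
  interpret U: char_two_cring "U_ring F" by (rule U_ring_char_two_cring)
  define y where "y = (Inl q :: ('a \<Rightarrow> 'a) + 'a)"
  have y: "y \<in> carrier (U_ring F)" using q by (simp add: y_def U_ring_simps)
  \<comment> \<open>Only positive powers are claimed to lie in Q(F), since y^0 = 1 belongs to
    F.\<close>
  have yQ: "\<exists>c\<in>carrier F. y [^]\<^bsub>U_ring F\<^esub> Suc m = Inl (qmap F c \<one>)" for m
  proof (induction m)
    case 0
    from q obtain c where "c \<in> carrier F" "q = qmap F c \<one>" by (rule Q_setE)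
    then show ?case using y by (auto simp: y_def)
  next
    case (Suc m)
    obtain c where c: "c \<in> carrier F" "y [^]\<^bsub>U_ring F\<^esub> Suc m = Inl (qmap F c \<one>)" using Suc by blast
    obtain d where d: "d \<in> carrier F" "y = Inl (qmap F d \<one>)" using q unfolding y_def by (auto elim: Q_setE)
    have "y [^]\<^bsub>U_ring F\<^esub> Suc (Suc m) = Inl (qmap F (c \<otimes> d \<boxplus> (c \<boxplus> d)) \<one>)"
      using c d by (simp add: nat_pow_def U_ring_simps(2) U_mult_Q_Q del: U_mult.simps)
    then show ?case using c d by blast
  qed
  have "\<not> inj (\<lambda>m::nat. y [^]\<^bsub>U_ring F\<^esub> m)"
    using finite_U_ring[OF fin] y
    by (metis U.nat_pow_closed finite_subset image_subsetI infinite_UNIV_nat finite_imageD)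
  then obtain i j :: nat where "i < j" and ij: "y [^]\<^bsub>U_ring F\<^esub> i = y [^]\<^bsub>U_ring F\<^esub> j"
    unfolding inj_def by (metis linorder_neqE_nat)
  then obtain l where l: "j = i + Suc l" using less_iff_Suc_add by auto
  obtain c where c: "c \<in> carrier F" "y [^]\<^bsub>U_ring F\<^esub> Suc l = Inl (qmap F c \<one>)" using yQ by blast
  \<comment> \<open>The sum 1 + y^(l + 1) is \<open>\<one> \<boxplus> c = c\<close> in F, so the
    inverse of \<open>c\<close> in F inverts it.\<close>
  have unit: "(\<one>\<^bsub>U_ring F\<^esub> \<oplus>\<^bsub>U_ring F\<^esub> y [^]\<^bsub>U_ring F\<^esub> Suc l) \<otimes>\<^bsub>U_ring F\<^esub> Inr (inv c) = \<one>\<^bsub>U_ring F\<^esub>"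
    using c by (simp add: U_ring_simps(2-) U_ops del: U_add.simps U_mult.simps)
  have "y [^]\<^bsub>U_ring F\<^esub> i \<otimes>\<^bsub>U_ring F\<^esub> (\<one>\<^bsub>U_ring F\<^esub> \<oplus>\<^bsub>U_ring F\<^esub> y [^]\<^bsub>U_ring F\<^esub> Suc l) =
      y [^]\<^bsub>U_ring F\<^esub> i \<oplus>\<^bsub>U_ring F\<^esub> y [^]\<^bsub>U_ring F\<^esub> j"
    using y unfolding l by (simp only: U.r_distr U.nat_pow_mult[symmetric] U.one_closed U.nat_pow_closed U.r_one)
  also have "\<dots> = \<zero>\<^bsub>U_ring F\<^esub>" using ij y by simp
  finally have 0: "y [^]\<^bsub>U_ring F\<^esub> i \<otimes>\<^bsub>U_ring F\<^esub> (\<one>\<^bsub>U_ring F\<^esub> \<oplus>\<^bsub>U_ring F\<^esub> y [^]\<^bsub>U_ring F\<^esub> Suc l) = \<zero>\<^bsub>U_ring F\<^esub>" .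
  have "y [^]\<^bsub>U_ring F\<^esub> i = y [^]\<^bsub>U_ring F\<^esub> i \<otimes>\<^bsub>U_ring F\<^esub>
      ((\<one>\<^bsub>U_ring F\<^esub> \<oplus>\<^bsub>U_ring F\<^esub> y [^]\<^bsub>U_ring F\<^esub> Suc l) \<otimes>\<^bsub>U_ring F\<^esub> Inr (inv c))"
    unfolding unit using y by simp
  also have "\<dots> = \<zero>\<^bsub>U_ring F\<^esub> \<otimes>\<^bsub>U_ring F\<^esub> Inr (inv c)"
    using y c(1) unfolding 0[symmetric]
    by (intro U.m_assoc[symmetric] U.a_closed U.nat_pow_closed U.one_closed) simp_all
  also have "\<dots> = \<zero>\<^bsub>U_ring F\<^esub>" using c(1) by simp
  finally show ?thesis unfolding y_def by blast
qed

text \<open>The odd values of x lie in F by minimality and form a 3-subfield containing x. As x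
  generates F, they exhaust it, and \<open>odd_values_isomorphic_F0\<close> applies with
  \<open>Inr\<close>.\<close>

lemma generated_isomorphic_F0:
  assumes fin: "finite (carrier F)" and gen: "generated_by F x"
  shows "\<exists>n\<ge>1. is_nilpotency_index (U_ring F) (\<one>\<^bsub>U_ring F\<^esub> \<ominus>\<^bsub>U_ring F\<^esub> Inr x) n \<and>
    isomorphic_3field F (F0 n)"
proof -
  interpret U: char_two_cring "U_ring F" by (rule U_ring_char_two_cring)
  have x: "x \<in> carrier F" using gen by (simp add: generated_by_def)
  have xU: "Inr x \<in> carrier (U_ring F)" using x by simp
  have y: "\<one>\<^bsub>U_ring F\<^esub> \<ominus>\<^bsub>U_ring F\<^esub> Inr x = \<one>\<^bsub>U_ring F\<^esub> \<oplus>\<^bsub>U_ring F\<^esub> Inr x"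
    using xU by (rule U.a_minus_add)
  have "\<one>\<^bsub>U_ring F\<^esub> \<oplus>\<^bsub>U_ring F\<^esub> Inr x = Inl (qmap F \<one> x)"
    by (simp add: U_ring_simps(2-))
  moreover have "qmap F \<one> x \<in> Q_set F" using x by (auto simp: Q_set_def)
  ultimately obtain n :: nat where n: "is_nilpotency_index (U_ring F) (\<one>\<^bsub>U_ring F\<^esub> \<oplus>\<^bsub>U_ring F\<^esub> Inr x) n"
    using Q_nilpotent[OF fin] is_nilpotency_index_exists by metis
  have "n \<noteq> 0"
  proof
    assume "n = 0"
    then have "\<one>\<^bsub>U_ring F\<^esub> = \<zero>\<^bsub>U_ring F\<^esub>" using n by (simp add: is_nilpotency_index_def)
    \<comment> \<open>The unit carries the tag \<open>Inr\<close>, the zero the tag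
      \<open>Inl\<close>.\<close>
    then show False by (simp add: U_ring_simps(3) zero_U_ring)
  qed
  define H where "H = U.odd_values (Inr x)"
  have HF: "H \<subseteq> Inr ` carrier F"
    unfolding H_def
  proof (rule U.odd_values_minimal[OF xU])
    fix a b c :: "('a \<Rightarrow> 'a) + 'a"
    assume "a \<in> Inr ` carrier F" "b \<in> Inr ` carrier F" "c \<in> Inr ` carrier F"
    then show "a \<oplus>\<^bsub>U_ring F\<^esub> b \<oplus>\<^bsub>U_ring F\<^esub> c \<in> Inr ` carrier F"
      by (auto simp: U_ring_tadd tadd_closed)
  qed (use x in \<open>auto simp: U_ring_simps\<close>)
  have "unital_3subfield {f \<in> carrier F. Inr f \<in> H} F"
  proof (rule unital_3subfieldI)
    show "\<one> \<in> {f \<in> carrier F. Inr f \<in> H}"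
      using U.one_odd_values[OF xU] by (simp add: H_def U_ring_simps(3))
  next
    fix a b assume "a \<in> {f \<in> carrier F. Inr f \<in> H}" "b \<in> {f \<in> carrier F. Inr f \<in> H}"
    then show "a \<otimes> b \<in> {f \<in> carrier F. Inr f \<in> H}"
      using U.mult_odd_values[OF xU, of "Inr a" "Inr b"] by (simp add: H_def U_ring_simps(2))
  next
    fix a assume a: "a \<in> {f \<in> carrier F. Inr f \<in> H}"
    then obtain b where b: "b \<in> H" "Inr a \<otimes>\<^bsub>U_ring F\<^esub> b = \<one>\<^bsub>U_ring F\<^esub>"
      using U.inverse_odd_values[OF xU n, of "Inr a"] by (auto simp: H_def)
    then obtain c where c: "c \<in> carrier F" "b = Inr c" using HF by blast
    then have "inv a = c" using a b(2) by (intro inv_equality) (auto simp: U_ring_simps(2,3) m_comm)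
    then show "inv a \<in> {f \<in> carrier F. Inr f \<in> H}" using b c by simp
  next
    fix a b c assume "a \<in> {f \<in> carrier F. Inr f \<in> H}" "b \<in> {f \<in> carrier F. Inr f \<in> H}"
      "c \<in> {f \<in> carrier F. Inr f \<in> H}"
    then show "tadd F a b c \<in> {f \<in> carrier F. Inr f \<in> H}"
      using U.add_odd_values[OF xU, of "Inr a" "Inr b" "Inr c"]
      by (simp add: H_def U_ring_tadd tadd_closed)
  qed blast
  moreover have "Inr x \<in> H" unfolding H_def by (rule U.x_odd_values[OF xU])
  ultimately have "{f \<in> carrier F. Inr f \<in> H} = carrier F"
    using gen unfolding generated_by_def by blast
  then have "H = Inr ` carrier F" using HF by blast
  then have "bij_betw Inr (carrier F) (U.odd_values (Inr x))"
    by (simp add: bij_betw_def H_def)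
  then have "isomorphic_3field F (F0 n)"
    by (rule U.odd_values_isomorphic_F0[OF xU n]) (simp_all add: U_ring_tadd, simp add: U_ring_simps)
  then show ?thesis using n \<open>n \<noteq> 0\<close> by (intro exI[of _ n]) (simp add: y)
qed

end

section \<open>The 3-subfield generated by P and its nilpotency index\<close>

lemma (in char_two_cring) generated_3subfield:
  fixes G :: "('a, 'm) three_field_scheme"
  assumes x: "x \<in> carrier R" and n: "is_nilpotency_index R (\<one> \<oplus> x) n"
    and G: "carrier G \<subseteq> carrier R" "odd_values x \<subseteq> carrier G"
    and ops: "monoid.mult G = monoid.mult R" "\<one>\<^bsub>G\<^esub> = \<one>" "\<And>a b c. tadd G a b c = a \<oplus> b \<oplus> c"
  shows "gen_3subfield G x = odd_values x" "isomorphic_3field (G\<lparr>carrier := gen_3subfield G x\<rparr>) (F0 n)"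
proof -
  note odd = odd_values_subset one_odd_values x_odd_values mult_odd_values add_odd_values
  have "unital_3field (G\<lparr>carrier := odd_values x\<rparr>)"
  proof (rule unital_3field_of_subset)
    fix a assume "a \<in> carrier (G\<lparr>carrier := odd_values x\<rparr>)"
    then show "\<exists>b\<in>carrier (G\<lparr>carrier := odd_values x\<rparr>). a \<otimes> b = \<one>"
      using inverse_odd_values[OF x n, of a] by auto
  qed (use ops odd[OF x] in auto)
  then have "unital_3subfield (odd_values x) G"
    using G by (simp add: unital_3subfield_def)
  \<comment> \<open>A 3-subfield containing x has all the closure properties in
    \<open>odd_values_minimal\<close>, so the odd values are the least one.\<close>
  moreover have "odd_values x \<subseteq> K" if K: "unital_3subfield K G" "x \<in> K" for K
  proof -
    interpret K: unital_3field "G\<lparr>carrier := K\<rparr>" using K by (simp add: unital_3subfield_def)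
    show ?thesis
      using K G K.one_closed K.m_closed K.tadd_closed
      by (intro odd_values_minimal[OF x]) (auto simp: unital_3subfield_def ops)
  qed
  ultimately show *: "gen_3subfield G x = odd_values x"
    unfolding gen_3subfield_def using x_odd_values[OF x] by (intro equalityI Inter_lower Inter_greatest) auto
  show "isomorphic_3field (G\<lparr>carrier := gen_3subfield G x\<rparr>) (F0 n)"
    unfolding *
    by (rule odd_values_isomorphic_F0[OF x n, where e = "\<lambda>a. a"]) (simp_all add: ops bij_betw_def)
qed

lemma xm1_adic_factorization:
  assumes "k = Min {i \<in> {1..<n}. \<eta> i \<noteq> 0}" "{i \<in> {1..<n}. \<eta> i \<noteq> 0} \<noteq> {}"
  obtains r where "(\<Sum>i = 1..<n. smult (\<eta> i) (xm1 ^ i)) = xm1 ^ k * r" "poly r 1 = 1"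
proof -
  define S where "S = {i \<in> {1..<n}. \<eta> i \<noteq> 0}"
  have S: "finite S" "k \<in> S" "\<And>i. i \<in> S \<Longrightarrow> k \<le> i"
    using assms Min_in[of S] Min_le[of S] by (auto simp: S_def)
  have "(\<Sum>i = 1..<n. smult (\<eta> i) (xm1 ^ i)) = (\<Sum>i\<in>S. xm1 ^ i)"
    by (rule sum.mono_neutral_cong_right) (auto simp: S_def)
  also have "\<dots> = (\<Sum>i\<in>S. xm1 ^ k * xm1 ^ (i - k))"
    using S by (intro sum.cong) (simp_all flip: power_add)
  finally have 1: "(\<Sum>i = 1..<n. smult (\<eta> i) (xm1 ^ i)) = xm1 ^ k * (\<Sum>i\<in>S. xm1 ^ (i - k))"
    by (simp add: sum_distrib_left)
  \<comment> \<open>At 1 every power (x - 1)^(i - k) vanishes except the one of exponent 0, that is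
    i = k.\<close>
  have "poly (\<Sum>i\<in>S. xm1 ^ (i - k)) 1 = (\<Sum>i\<in>S. if i = k then 1 else 0)"
    unfolding poly_sum using S(3) by (intro sum.cong) (force simp: power_0_left)+
  then have "poly (\<Sum>i\<in>S. xm1 ^ (i - k)) 1 = 1" using S by simp
  with 1 that show ?thesis by blast
qed

theorem theorem3p4:
  shows "(\<forall>(F :: 'a three_field) x.
            unital_3field F \<and> finite (carrier F) \<and> char_one F \<and> generated_by F x \<longrightarrow>
            (\<exists>n\<ge>1. is_nilpotency_index (U_ring F) (\<one>\<^bsub>U_ring F\<^esub> \<ominus>\<^bsub>U_ring F\<^esub> Inr x) n \<and>
                   isomorphic_3field F (F0 n))) \<and>
         (\<forall>n\<ge>1. \<forall>\<eta> :: nat \<Rightarrow> bit. \<forall>P k.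
            P = F0_elem n \<eta> \<and> P \<noteq> \<one>\<^bsub>F0 n\<^esub> \<and> k = Min {i \<in> {1..<n}. \<eta> i \<noteq> 0} \<longrightarrow>
            (\<exists>n\<^sub>P. is_nilpotency_index (F2x_quot n) (P \<ominus>\<^bsub>F2x_quot n\<^esub> \<one>\<^bsub>F2x_quot n\<^esub>) n\<^sub>P \<and>
                   isomorphic_3field ((F0 n)\<lparr>carrier := gen_3subfield (F0 n) P\<rparr>) (F0 n\<^sub>P) \<and>
                   int n\<^sub>P = \<lceil>real n / real k\<rceil>))"
proof (intro conjI allI impI; (elim conjE)?)
  fix F :: "'a three_field" and x
  assume "unital_3field F" "finite (carrier F)" "char_one F" "generated_by F x"
  then show "\<exists>n\<ge>1. is_nilpotency_index (U_ring F) (\<one>\<^bsub>U_ring F\<^esub> \<ominus>\<^bsub>U_ring F\<^esub> Inr x) n \<and>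
      isomorphic_3field F (F0 n)"
    by (intro char_one_3field.generated_isomorphic_F0 char_one_3field.intro char_one_3field_axioms.intro)
next
  fix n :: nat and \<eta> :: "nat \<Rightarrow> bit" and P k
  assume n: "n \<ge> 1" and P: "P = F0_elem n \<eta>" "P \<noteq> \<one>\<^bsub>F0 n\<^esub>" and k: "k = Min {i \<in> {1..<n}. \<eta> i \<noteq> 0}"
  interpret Q: char_two_cring "F2x_quot n" by (rule F2x_quot_char_two_cring)
  let ?s = "\<Sum>i = 1..<n. smult (\<eta> i) (xm1 ^ i)"
  have Pcls: "P = cls n (1 + ?s)" by (simp add: P(1) F0_elem_cls)
  have "\<one>\<^bsub>F0 n\<^esub> = cls n 1" by (simp add: F0_def F2x_quot_simps)
  \<comment> \<open>If all digits vanished, P would be 1. So the minimum defining \<open>k\<close>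
    is taken over a nonempty set.\<close>
  then have "{i \<in> {1..<n}. \<eta> i \<noteq> 0} \<noteq> {}"
    using P(2) unfolding Pcls by (auto intro!: arg_cong[where f = "cls n"] sum.neutral)
  then obtain r where r: "?s = xm1 ^ k * r" "poly r 1 = 1" and "k \<ge> 1"
    using xm1_adic_factorization[OF k] Min_in[of "{i \<in> {1..<n}. \<eta> i \<noteq> 0}"] unfolding k by auto
  have PQ: "P \<in> carrier (F2x_quot n)" by (simp add: Pcls F2x_quot_simps)
  have P1: "P \<ominus>\<^bsub>F2x_quot n\<^esub> \<one>\<^bsub>F2x_quot n\<^esub> = \<one>\<^bsub>F2x_quot n\<^esub> \<oplus>\<^bsub>F2x_quot n\<^esub> P"
    using PQ by (simp add: Q.a_minus_add Q.a_comm)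
  have y: "\<one>\<^bsub>F2x_quot n\<^esub> \<oplus>\<^bsub>F2x_quot n\<^esub> P = cls n (xm1 ^ k * r)"
    unfolding r(1)[symmetric] by (simp add: Pcls F2x_quot_simps flip: add.assoc)
  \<comment> \<open>The m-th power is the class of (x - 1)^(k m) r^m, and r^m still takes the value
    1 at 1.\<close>
  have pow: "(\<one>\<^bsub>F2x_quot n\<^esub> \<oplus>\<^bsub>F2x_quot n\<^esub> P) [^]\<^bsub>F2x_quot n\<^esub> m = \<zero>\<^bsub>F2x_quot n\<^esub> \<longleftrightarrow> n \<le> k * m"
    for m :: nat
    using xm1_power_dvd_iff[of "r ^ m" n "k * m"] r(2)
    by (simp add: y nat_pow_cls F2x_quot_zero cls_eq_iff power_mult_distrib power_mult)
  define n\<^sub>P where "n\<^sub>P = nat \<lceil>real n / real k\<rceil>"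
  have "0 \<le> real n / real k" by simp
  then have int_nP: "int n\<^sub>P = \<lceil>real n / real k\<rceil>"
    unfolding n\<^sub>P_def by linarith
  \<comment> \<open>The ceiling of n / k is the least m with n \<le> k m. This equivalence gives
    both the vanishing at \<open>n\<^sub>P\<close> and its minimality.\<close>
  have le: "n \<le> k * m \<longleftrightarrow> n\<^sub>P \<le> m" for m
  proof -
    have "n\<^sub>P \<le> m \<longleftrightarrow> real n / real k \<le> real m"
      unfolding n\<^sub>P_def by (simp add: nat_le_iff ceiling_le_iff)
    also have "\<dots> \<longleftrightarrow> real n \<le> real (k * m)" using \<open>k \<ge> 1\<close> by (simp add: field_simps)
    finally show ?thesis by (simp only: of_nat_le_iff)
  qed
  have nP: "is_nilpotency_index (F2x_quot n) (\<one>\<^bsub>F2x_quot n\<^esub> \<oplus>\<^bsub>F2x_quot n\<^esub> P) n\<^sub>P"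
    by (simp add: is_nilpotency_index_def pow le)
  have "carrier (F0 n) \<subseteq> carrier (F2x_quot n)" by (auto simp: carrier_F0 F2x_quot_simps)
  moreover have "Q.odd_values P \<subseteq> carrier (F0 n)"
  proof (rule Q.odd_values_minimal[OF PQ])
    show "P \<in> carrier (F0 n)" by (simp add: P(1) F0_def)
  qed (auto simp: carrier_F0 F2x_quot_simps)
  ultimately have "isomorphic_3field ((F0 n)\<lparr>carrier := gen_3subfield (F0 n) P\<rparr>) (F0 n\<^sub>P)"
    by (rule Q.generated_3subfield(2)[OF PQ nP]) (simp_all add: F0_def)
  then show "\<exists>n\<^sub>P. is_nilpotency_index (F2x_quot n) (P \<ominus>\<^bsub>F2x_quot n\<^esub> \<one>\<^bsub>F2x_quot n\<^esub>) n\<^sub>P \<and>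
      isomorphic_3field ((F0 n)\<lparr>carrier := gen_3subfield (F0 n) P\<rparr>) (F0 n\<^sub>P) \<and>
      int n\<^sub>P = \<lceil>real n / real k\<rceil>"
    using nP int_nP unfolding P1 by blast
qed

end
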